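(* Let $n\ge 2$, $N=n^2+n+1$, $k$ a positive integer, and let $r_1\ge r_2\ge\dots\ge r_N\ge 1$ be integers. If $$\sum_{i=n+2}^{N} r_i-(k-1)\sum_{i=1}^{n+1} r_i>2k(n+1),$$ then $\mu_{\mathrm{int}}\big(Erd(r_1,\dots,r_N)\big)>k$.
   Context: Graphs are finite and simple. A $k$-improper edge coloring of a graph $G$ is a map $\alpha:E(G)\to\mathbb{N}$ such that at most $k$ edges with a common endpoint receive the same color; it is an improper interval coloring if at every vertex the colors on incident edges form a set of consecutive integers. $\mu_{\mathrm{int}}(G)$ is the smallest $k$ such that $G$ has a $k$-improper interval edge coloring. Let $\pi(n)$ be a finite projective plane of order $n\ge2$ with point set $\{1,\dots,N\}$, $N=n^2+n+1$, and line set $\{l_1,\dots,l_N\}$; let $A_i\subseteq\{1,\dots,N\}$ be the set of points on $l_i$ (so $|A_i|=n+1$). The graph $Erd(r_1,\dots,r_N)$ has vertex set $\{u\}\cup\{1,\dots,N\}\cup\{v^{(l_i)}_1,\dots,v^{(l_i)}_{r_i}:1\le i\le N\}$ and edge set consisting, for each $1\le i\le N$, of the edges $uv^{(l_i)}_j$ ($1\le j\le r_i$) and the edges $v^{(l_i)}_j p$ for $1\le j\le r_i$ and $p\in A_i$. *)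

theory Defs
  imports Main
begin

text \<open>A graph is a pair of a vertex set and a set of two-element sets of vertices.\<close>

type_synonym 'a ugraph = "'a set \<times> 'a set set"

definition verts :: "'a ugraph \<Rightarrow> 'a set" where
  "verts G = fst G"

definition edges :: "'a ugraph \<Rightarrow> 'a set set" where
  "edges G = snd G"

definition finite_simple_graph :: "'a ugraph \<Rightarrow> bool" where
  "finite_simple_graph G \<longleftrightarrow>
     finite (verts G) \<and> (\<forall>e \<in> edges G. e \<subseteq> verts G \<and> card e = 2)"

definition incident_edges :: "'a ugraph \<Rightarrow> 'a \<Rightarrow> 'a set set" where
  "incident_edges G v = {e \<in> edges G. v \<in> e}"

text \<open>Colorings are total functions on sets of vertices; only their values on the edges matter.\<close>

definition improper_edge_coloring :: "nat \<Rightarrow> 'a ugraph \<Rightarrow> ('a set \<Rightarrow> nat) \<Rightarrow> bool" where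
  "improper_edge_coloring k G \<alpha> \<longleftrightarrow>
     (\<forall>v \<in> verts G. \<forall>c. card {e \<in> incident_edges G v. \<alpha> e = c} \<le> k)"

text \<open>An isolated vertex sees the empty set of colors, which counts as an interval.\<close>

definition improper_interval_edge_coloring :: "nat \<Rightarrow> 'a ugraph \<Rightarrow> ('a set \<Rightarrow> nat) \<Rightarrow> bool" where
  "improper_interval_edge_coloring k G \<alpha> \<longleftrightarrow>
     improper_edge_coloring k G \<alpha> \<and>
     (\<forall>v \<in> verts G. \<exists>a b. \<alpha> ` incident_edges G v = {a..b})"

definition mu_int :: "'a ugraph \<Rightarrow> nat" where
  "mu_int G = (LEAST k. \<exists>\<alpha>. improper_interval_edge_coloring k G \<alpha>)"

text \<open>The minimum is attained: in a finite graph a constant coloring is an improper interval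
  coloring for large \<open>k\<close>.\<close>

lemma ex_improper_interval_edge_coloring:
  assumes "finite_simple_graph G"
  shows "\<exists>k \<alpha>. improper_interval_edge_coloring k G \<alpha>"
proof -
  have "edges G \<subseteq> Pow (verts G)" and "finite (verts G)"
    using assms by (auto simp: finite_simple_graph_def)
  then have fin: "finite (edges G)"
    using finite_subset by blast
  have "improper_edge_coloring (card (edges G)) G (\<lambda>_. 0)"
    unfolding improper_edge_coloring_def incident_edges_def
    by (auto intro!: card_mono fin)
  moreover have "\<exists>a b. (\<lambda>_. 0::nat) ` incident_edges G v = {a..b}" for v
  proof (cases "incident_edges G v = {}")
    case True
    then have "(\<lambda>_. 0::nat) ` incident_edges G v = {1..0}" by simp
    then show ?thesis by blast
  next
    case False
    then have "(\<lambda>_. 0::nat) ` incident_edges G v = {0..0}" by auto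
    then show ?thesis by blast
  qed
  ultimately show ?thesis
    unfolding improper_interval_edge_coloring_def by blast
qed

text \<open>Lines are identified with their sets of points.\<close>

definition finite_projective_plane :: "nat \<Rightarrow> 'p set \<Rightarrow> 'p set set \<Rightarrow> bool" where
  "finite_projective_plane n P L \<longleftrightarrow>
     finite P \<and> (\<forall>l \<in> L. l \<subseteq> P) \<and>
     (\<forall>p \<in> P. \<forall>q \<in> P. p \<noteq> q \<longrightarrow> (\<exists>!l. l \<in> L \<and> p \<in> l \<and> q \<in> l)) \<and>
     (\<forall>l \<in> L. \<forall>m \<in> L. l \<noteq> m \<longrightarrow> (\<exists>!p. p \<in> l \<and> p \<in> m)) \<and>
     (\<exists>Q \<subseteq> P. card Q = 4 \<and> (\<forall>l \<in> L. card (Q \<inter> l) \<le> 2)) \<and>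
     (\<forall>l \<in> L. card l = n + 1)"

text \<open>\<open>LineV i j\<close> is the \<open>j\<close>-th of the \<open>r i\<close> vertices attached to the line with point set \<open>A i\<close>;
  the vertex \<open>Apex\<close> is called \<open>u\<close> in the literature.\<close>

datatype erd_vertex = Apex | Point nat | LineV nat nat

definition Erd :: "nat \<Rightarrow> (nat \<Rightarrow> nat set) \<Rightarrow> (nat \<Rightarrow> nat) \<Rightarrow> erd_vertex ugraph" where
  "Erd N A r =
     ({Apex} \<union> Point ` {1..N} \<union> {LineV i j | i j. i \<in> {1..N} \<and> j \<in> {1..r i}},
      {{Apex, LineV i j} | i j. i \<in> {1..N} \<and> j \<in> {1..r i}} \<union>
      {{LineV i j, Point p} | i j p. i \<in> {1..N} \<and> j \<in> {1..r i} \<and> p \<in> A i})"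

lemma finite_simple_graph_Erd:
  assumes "\<And>i. i \<in> {1..N} \<Longrightarrow> A i \<subseteq> {1..N}"
  shows "finite_simple_graph (Erd N A r)"
proof -
  have "{LineV i j | i j. i \<in> {1..N} \<and> j \<in> {1..r i}} = (\<Union>i\<in>{1..N}. LineV i ` {1..r i})"
    by auto
  then have "finite {LineV i j | i j. i \<in> {1..N} \<and> j \<in> {1..r i}}"
    by simp
  then have "finite (verts (Erd N A r))"
    by (simp add: verts_def Erd_def)
  moreover have "e \<subseteq> verts (Erd N A r) \<and> card e = 2" if "e \<in> edges (Erd N A r)" for e
  proof -
    from that consider
        i j where "e = {Apex, LineV i j}" "i \<in> {1..N}" "j \<in> {1..r i}"
      | i j p where "e = {LineV i j, Point p}" "i \<in> {1..N}" "j \<in> {1..r i}" "p \<in> A i"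
      unfolding edges_def Erd_def by auto
    then show ?thesis
    proof cases
      case 1
      then show ?thesis by (auto simp: verts_def Erd_def)
    next
      case 2
      then have "p \<in> {1..N}" using assms by blast
      with 2 show ?thesis by (auto simp: verts_def Erd_def)
    qed
  qed
  ultimately show ?thesis
    unfolding finite_simple_graph_def by blast
qed

end

theory Submission
  imports Defs
begin

text \<open>Let \<open>a\<close> and \<open>b\<close> be the extreme colors at \<open>Apex\<close>, on edges to line vertices \<open>x\<close> and \<open>y\<close>.
  The lines of \<open>x\<close> and \<open>y\<close> share a point \<open>p\<close>, so the color changes from \<open>a\<close> to \<open>b\<close> along a path
  through \<open>x\<close>, \<open>p\<close> and \<open>y\<close>. The interval condition bounds the change at each of these vertices by
  its degree minus one, and the degree of \<open>p\<close> is at most \<open>S = r 1 + \<dots> + r (n + 1)\<close>, because \<open>n + 1\<close>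
  lines pass through \<open>p\<close>. Hence \<open>Apex\<close> sees at most \<open>2 (n + 1) + S\<close> colors, so its degree is at
  most \<open>k (2 (n + 1) + S)\<close>, which contradicts the hypothesis.\<close>

lemma improper_edge_coloring_mono:
  assumes "improper_edge_coloring k G \<alpha>" and "k \<le> m"
  shows "improper_edge_coloring m G \<alpha>"
  using assms unfolding improper_edge_coloring_def by (meson le_trans)

text \<open>The minimum is attained, and a coloring that is good for some bound stays good for every
  larger one. So refuting the single bound \<open>k\<close> also excludes all smaller ones.\<close>

lemma mu_int_greaterI:
  assumes "finite_simple_graph G"
    and "\<And>\<alpha>. \<not> improper_interval_edge_coloring k G \<alpha>"
  shows "k < mu_int G"
proof (rule ccontr)
  assume "\<not> k < mu_int G"
  then have le: "mu_int G \<le> k" by simp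
  obtain \<alpha> where "improper_interval_edge_coloring (mu_int G) G \<alpha>"
    using LeastI_ex[OF ex_improper_interval_edge_coloring[OF assms(1)]]
    unfolding mu_int_def by blast
  then have "improper_interval_edge_coloring k G \<alpha>"
    using improper_edge_coloring_mono[OF _ le]
    unfolding improper_interval_edge_coloring_def by blast
  with assms(2) show False by blast
qed

text \<open>An interval of colors at \<open>v\<close> has at most as many elements as there are
  edges at \<open>v\<close>. The strict form avoids truncated subtraction.\<close>

lemma color_less_color_plus_degree:
  assumes "improper_interval_edge_coloring k G \<alpha>" and "v \<in> verts G"
    and "finite (incident_edges G v)"
    and "e \<in> incident_edges G v" and "f \<in> incident_edges G v"
  shows "\<alpha> f < \<alpha> e + card (incident_edges G v)"
proof -
  obtain a b where ab: "\<alpha> ` incident_edges G v = {a..b}"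
    using assms(1,2) unfolding improper_interval_edge_coloring_def by blast
  have "\<alpha> e \<in> {a..b}" "\<alpha> f \<in> {a..b}"
    using assms(4,5) ab by blast+
  moreover have "card {a..b} \<le> card (incident_edges G v)"
    using card_image_le[OF assms(3), of \<alpha>] ab by simp
  ultimately show ?thesis by auto
qed

text \<open>Pigeonhole: the color classes partition \<open>X\<close>. This turns a bound on the
  number of colors at \<open>Apex\<close> into a bound on its degree.\<close>

lemma card_le_mult_card_image:
  assumes "finite X" and "\<And>c. card {x \<in> X. f x = c} \<le> k"
  shows "card X \<le> k * card (f ` X)"
proof -
  have "card X = (\<Sum>c\<in>f ` X. card {x \<in> X. f x = c})"
    using sum.image_gen[OF assms(1), of "\<lambda>_. 1::nat" f] by simp
  also have "\<dots> \<le> card (f ` X) * k"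
    using sum_bounded_above[of "f ` X" "\<lambda>c. card {x \<in> X. f x = c}" k] assms(2) by simp
  finally show ?thesis by (simp add: mult.commute)
qed

text \<open>Exchange argument with threshold \<open>r m\<close>: indices of \<open>T\<close> beyond
  \<open>m\<close> weigh at most \<open>r m\<close> each, indices up to \<open>m\<close> missing
  from \<open>T\<close> at least \<open>r m\<close> each, and the former are no more
  numerous.\<close>

lemma sum_le_sum_initial_segment:
  fixes r :: "nat \<Rightarrow> nat"
  assumes anti: "\<And>i j. 1 \<le> i \<Longrightarrow> i \<le> j \<Longrightarrow> j \<le> N \<Longrightarrow> r j \<le> r i"
    and "T \<subseteq> {1..N}" and "card T \<le> m" and "1 \<le> m" and "m \<le> N"
  shows "sum r T \<le> sum r {1..m}"
proof -
  have fin: "finite T" using assms(2) finite_subset by blast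
  have "card (T - {1..m}) \<le> card ({1..m} - T)"
  proof -
    have "card T = card (T \<inter> {1..m}) + card (T - {1..m})"
      using fin by (metis card_Int_Diff)
    moreover have "card {1..m} = card ({1..m} \<inter> T) + card ({1..m} - T)"
      by (metis card_Int_Diff finite_atLeastAtMost)
    ultimately show ?thesis using assms(3) by (simp add: Int_commute)
  qed
  moreover have "sum r (T - {1..m}) \<le> card (T - {1..m}) * r m"
  proof -
    have "r i \<le> r m" if "i \<in> T - {1..m}" for i
      using that assms(2,4) by (intro anti) auto
    then show ?thesis using sum_bounded_above[of "T - {1..m}" r "r m"] by simp
  qed
  moreover have "card ({1..m} - T) * r m \<le> sum r ({1..m} - T)"
  proof -
    have "r m \<le> r i" if "i \<in> {1..m} - T" for i
      using that assms(5) by (intro anti) auto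
    then show ?thesis using sum_bounded_below[of "{1..m} - T" "r m" r] by simp
  qed
  ultimately have "sum r (T - {1..m}) \<le> sum r ({1..m} - T)"
    by (meson le_trans mult_le_mono1)
  moreover have "sum r T = sum r (T \<inter> {1..m}) + sum r (T - {1..m})"
    using fin by (rule sum.Int_Diff)
  moreover have "sum r {1..m} = sum r ({1..m} \<inter> T) + sum r ({1..m} - T)"
    by (rule sum.Int_Diff) simp
  ultimately show ?thesis by (simp add: Int_commute)
qed

lemma finite_projective_planeD:
  assumes "finite_projective_plane n P L"
  shows "finite P"
    and "l \<in> L \<Longrightarrow> l \<subseteq> P"
    and "l \<in> L \<Longrightarrow> card l = n + 1"
    and "l \<in> L \<Longrightarrow> m \<in> L \<Longrightarrow> l \<noteq> m \<Longrightarrow> \<exists>!p. p \<in> l \<and> p \<in> m"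
  using assms unfolding finite_projective_plane_def by simp_all

text \<open>The lines through \<open>p\<close>, with \<open>p\<close> removed, are disjoint subsets of size \<open>n\<close> of the other
  \<open>n\<^sup>2 + n\<close> points.\<close>

lemma card_lines_through_point_le:
  assumes plane: "finite_projective_plane n P L" and "n \<ge> 1"
    and card_P: "card P = n ^ 2 + n + 1" and p: "p \<in> P"
  shows "card {l \<in> L. p \<in> l} \<le> n + 1"
proof -
  let ?M = "{l \<in> L. p \<in> l}"
  note fin = finite_projective_planeD(1)[OF plane]
    and sub = finite_projective_planeD(2)[OF plane]
    and card_l = finite_projective_planeD(3)[OF plane]
    and inter = finite_projective_planeD(4)[OF plane]
  have "finite L" using fin sub by (intro finite_subset[of L "Pow P"]) auto
  then have "finite ?M" by simp
  have fin_l: "finite l" if "l \<in> L" for l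
    using sub[OF that] fin finite_subset by blast
  have "card (\<Union>l\<in>?M. l - {p}) = (\<Sum>l\<in>?M. card (l - {p}))"
  proof (rule card_UN_disjoint)
    \<comment> \<open>The unique common point of two distinct lines in \<open>?M\<close> is
      \<open>p\<close>, which has been removed.\<close>
    show "\<forall>l\<in>?M. \<forall>m\<in>?M. l \<noteq> m \<longrightarrow> (l - {p}) \<inter> (m - {p}) = {}"
      using inter by blast
  qed (use \<open>finite ?M\<close> fin_l in auto)
  also have "\<dots> = (\<Sum>l\<in>?M. n)"
    by (rule sum.cong) (use card_l fin_l in auto)
  finally have "card ?M * n = card (\<Union>l\<in>?M. l - {p})" by simp
  also have "\<dots> \<le> card (P - {p})"
    by (rule card_mono) (use fin sub in auto)
  also have "\<dots> = (n + 1) * n"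
    using fin p card_P by (simp add: power2_eq_square)
  finally show ?thesis using \<open>n \<ge> 1\<close> by (simp only: mult_le_cancel2)
qed

lemma incident_edges_Erd_Apex:
  "incident_edges (Erd N A r) Apex = (\<lambda>(i, j). {Apex, LineV i j}) ` (SIGMA i:{1..N}. {1..r i})"
  unfolding incident_edges_def edges_def Erd_def by (auto simp: doubleton_eq_iff)

text \<open>Distinct pairs \<open>(i, j)\<close> give distinct edges. Equality matters here because
  the degree of \<open>Apex\<close> must be large; at the other vertices upper bounds
  suffice.\<close>

lemma card_incident_edges_Erd_Apex:
  "card (incident_edges (Erd N A r) Apex) = sum r {1..N}"
  unfolding incident_edges_Erd_Apex
  by (subst card_image) (auto simp: inj_on_def doubleton_eq_iff)

lemma incident_edges_Erd_LineV:
  assumes "i \<in> {1..N}" and "j \<in> {1..r i}"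
  shows "incident_edges (Erd N A r) (LineV i j) =
    insert {Apex, LineV i j} ((\<lambda>p. {LineV i j, Point p}) ` A i)"
  using assms unfolding incident_edges_def edges_def Erd_def by (auto simp: doubleton_eq_iff)

lemma card_incident_edges_Erd_LineV_le:
  assumes "i \<in> {1..N}" and "j \<in> {1..r i}" and "finite (A i)"
  shows "card (incident_edges (Erd N A r) (LineV i j)) \<le> card (A i) + 1"
  using card_image_le[OF assms(3), of "\<lambda>p. {LineV i j, Point p}"] assms
  by (simp add: incident_edges_Erd_LineV card_insert_if)

lemma incident_edges_Erd_Point:
  "incident_edges (Erd N A r) (Point p) =
    (\<lambda>(i, j). {LineV i j, Point p}) ` (SIGMA i:{i \<in> {1..N}. p \<in> A i}. {1..r i})"
  unfolding incident_edges_def edges_def Erd_def by (auto simp: doubleton_eq_iff)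

lemma card_incident_edges_Erd_Point_le:
  "card (incident_edges (Erd N A r) (Point p)) \<le> sum r {i \<in> {1..N}. p \<in> A i}"
proof -
  have "card (incident_edges (Erd N A r) (Point p))
      \<le> card (SIGMA i:{i \<in> {1..N}. p \<in> A i}. {1..r i})"
    unfolding incident_edges_Erd_Point by (rule card_image_le) auto
  then show ?thesis by simp
qed

theorem theorem16:
  fixes n N k :: nat and L :: "nat set set" and A :: "nat \<Rightarrow> nat set" and r :: "nat \<Rightarrow> nat"
  assumes "n \<ge> 2"
    and "N = n ^ 2 + n + 1"
    and "k \<ge> 1"
    and "finite_projective_plane n {1..N} L"
    and "bij_betw A {1..N} L"
    and "\<And>i j. 1 \<le> i \<Longrightarrow> i \<le> j \<Longrightarrow> j \<le> N \<Longrightarrow> r j \<le> r i"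
    and "r N \<ge> 1"
    and "(\<Sum>i = n + 2..N. int (r i)) - (int k - 1) * (\<Sum>i = 1..n + 1. int (r i))
           > 2 * int k * (int n + 1)"
  shows "mu_int (Erd N A r) > k"
proof (rule mu_int_greaterI)
  have A_L: "A i \<in> L" if "i \<in> {1..N}" for i
    using \<open>bij_betw A {1..N} L\<close> that by (rule bij_betw_apply)
  have sub: "A i \<subseteq> {1..N}" and card_A: "card (A i) = n + 1" if "i \<in> {1..N}" for i
    using finite_projective_planeD(2,3)[OF assms(4) A_L[OF that]] by auto
  \<comment> \<open>The indices may coincide, as both extreme colors at \<open>Apex\<close> can lead
    to the same line; then any of its points serves.\<close>
  have meet: "\<exists>p. p \<in> A i \<and> p \<in> A j" if "i \<in> {1..N}" "j \<in> {1..N}" for i j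
  proof (cases "A i = A j")
    case True
    have "A i \<noteq> {}" using card_A[OF that(1)] by force
    with True show ?thesis by blast
  next
    case False
    then show ?thesis
      using finite_projective_planeD(4)[OF assms(4) A_L[OF that(1)] A_L[OF that(2)]] by blast
  qed
  have fin_A: "finite (A i)" if "i \<in> {1..N}" for i
    using sub[OF that] finite_subset by blast
  let ?G = "Erd N A r" and ?S = "sum r {1..n + 1}"
  show simple: "finite_simple_graph ?G"
    using sub by (rule finite_simple_graph_Erd)
  have fin: "finite (incident_edges ?G v)" for v
  proof -
    have "edges ?G \<subseteq> Pow (verts ?G)" "finite (verts ?G)"
      using simple unfolding finite_simple_graph_def by auto
    then show ?thesis
      unfolding incident_edges_def by (simp add: finite_subset)
  qed
  have deg_Point: "card (incident_edges ?G (Point p)) \<le> ?S" if p: "p \<in> {1..N}" for p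
  proof -
    \<comment> \<open>Since \<open>A\<close> is a bijection onto \<open>L\<close>, counting indices
      \<open>i\<close> with \<open>p \<in> A i\<close> amounts to counting lines through
      \<open>p\<close>.\<close>
    have A_image: "A ` {i \<in> {1..N}. p \<in> A i} = {l \<in> L. p \<in> l}"
      using bij_betw_imp_surj_on[OF assms(5)] by blast
    have "inj_on A {i \<in> {1..N}. p \<in> A i}"
      using bij_betw_imp_inj_on[OF assms(5)] by (rule inj_on_subset) blast
    from card_image[OF this]
    have "card {i \<in> {1..N}. p \<in> A i} = card {l \<in> L. p \<in> l}"
      unfolding A_image by (rule sym)
    also have "\<dots> \<le> n + 1"
      using card_lines_through_point_le[OF assms(4) _ _ p] assms(1,2) by simp
    finally have card_le: "card {i \<in> {1..N}. p \<in> A i} \<le> n + 1" .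
    have "sum r {i \<in> {1..N}. p \<in> A i} \<le> ?S"
    proof (rule sum_le_sum_initial_segment)
      show "r j \<le> r i" if "1 \<le> i" "i \<le> j" "j \<le> N" for i j
        using that by (rule assms(6))
      show "n + 1 \<le> N" using assms(2) by simp
    qed (use card_le in auto)
    with card_incident_edges_Erd_Point_le show ?thesis by (rule le_trans)
  qed
  fix \<alpha>
  show "\<not> improper_interval_edge_coloring k ?G \<alpha>"
  proof
    assume col: "improper_interval_edge_coloring k ?G \<alpha>"
    have Apex: "Apex \<in> verts ?G" by (simp add: verts_def Erd_def)
    obtain a b where ab: "\<alpha> ` incident_edges ?G Apex = {a..b}"
      using col Apex unfolding improper_interval_edge_coloring_def by blast
    \<comment> \<open>As \<open>r N \<ge> 1\<close>, \<open>Apex\<close> has an edge. This rules out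
      an empty \<open>{a..b}\<close>, so \<open>a\<close> and \<open>b\<close> are colors that
      really occur.\<close>
    have "r N \<le> sum r {1..N}"
      using assms(2) by (intro member_le_sum) auto
    then have "incident_edges ?G Apex \<noteq> {}"
      using card_incident_edges_Erd_Apex[of N A r] assms(7) by auto
    then have "a \<le> b" using ab by auto
    then have "a \<in> \<alpha> ` incident_edges ?G Apex" "b \<in> \<alpha> ` incident_edges ?G Apex"
      unfolding ab by auto
    then obtain i j i' j' where
      ij: "i \<in> {1..N}" "j \<in> {1..r i}" "a = \<alpha> {Apex, LineV i j}" and
      ij': "i' \<in> {1..N}" "j' \<in> {1..r i'}" "b = \<alpha> {Apex, LineV i' j'}"
      unfolding incident_edges_Erd_Apex by auto
    obtain p where p: "p \<in> A i" "p \<in> A i'"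
      using meet ij(1) ij'(1) by blast
    then have pN: "p \<in> {1..N}" using sub ij(1) by blast
    \<comment> \<open>A line vertex has degree at most \<open>n + 2\<close>: the
      \<open>n + 1\<close> points of its line, and \<open>Apex\<close>.\<close>
    have at_line: "\<alpha> f < \<alpha> e + (n + 2)"
      if "x \<in> {1..N}" "y \<in> {1..r x}"
        "e \<in> incident_edges ?G (LineV x y)" "f \<in> incident_edges ?G (LineV x y)" for x y e f
    proof -
      have "LineV x y \<in> verts ?G"
        using that by (simp add: verts_def Erd_def)
      then show ?thesis
        using color_less_color_plus_degree[OF col _ fin that(3,4)]
          card_incident_edges_Erd_LineV_le[of x N y r A, OF that(1,2) fin_A[OF that(1)]]
          card_A[OF that(1)]
        by simp
    qed
    have "\<alpha> {LineV i j, Point p} < a + (n + 2)"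
      unfolding ij(3) using ij(1,2) p
      by (intro at_line[of i j]) (simp_all add: incident_edges_Erd_LineV)
    moreover have "b < \<alpha> {LineV i' j', Point p} + (n + 2)"
      unfolding ij'(3) using ij'(1,2) p
      by (intro at_line[of i' j']) (simp_all add: incident_edges_Erd_LineV)
    moreover have "\<alpha> {LineV i' j', Point p}
        < \<alpha> {LineV i j, Point p} + card (incident_edges ?G (Point p))"
    proof (rule color_less_color_plus_degree[OF col _ fin])
      show "Point p \<in> verts ?G" using pN by (simp add: verts_def Erd_def)
    qed (use ij ij' p in \<open>auto simp: incident_edges_Erd_Point\<close>)
    \<comment> \<open>The changes add up to at most \<open>(n + 1) + (?S - 1) + (n + 1)\<close>;
      counting both end colors adds one.\<close>
    ultimately have colors: "b + 1 - a \<le> 2 * (n + 1) + ?S"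
      using deg_Point[OF pN] by simp
    have "card (incident_edges ?G Apex) \<le> k * card (\<alpha> ` incident_edges ?G Apex)"
      using col Apex unfolding improper_interval_edge_coloring_def improper_edge_coloring_def
      by (intro card_le_mult_card_image[OF fin]) blast
    then have "sum r {1..N} \<le> k * (b + 1 - a)"
      unfolding card_incident_edges_Erd_Apex ab by simp
    also have "\<dots> \<le> k * (2 * (n + 1) + ?S)"
      using colors by (rule mult_le_mono2)
    finally have "sum r {1..N} \<le> k * (2 * (n + 1) + ?S)" .
    moreover have "sum r {1..N} = ?S + sum r {n + 2..N}"
      using sum.ub_add_nat[of 1 "n + 1" r "n ^ 2"] assms(2) by (simp add: ac_simps)
    ultimately have "?S + sum r {n + 2..N} \<le> k * (2 * (n + 1) + ?S)"
      by (simp only:)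
    \<comment> \<open>Over the integers, moving \<open>?S\<close> to the right gives
      \<open>(k - 1) * ?S + 2 * k * (n + 1)\<close> as an upper bound for the tail sum, the negation
      of the hypothesis.\<close>
    then have "int (?S + sum r {n + 2..N}) \<le> int (k * (2 * (n + 1) + ?S))"
      by (simp only: of_nat_le_iff)
    with assms(8) show False
      unfolding of_nat_sum[symmetric] by (simp add: algebra_simps del: of_nat_sum)
  qed
qed

end
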